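(* Let $\mathcal E=\mathcal A\sqcup\mathcal I$ and let $\mathcal G$ be partitioned into $L$ nonempty forests $\{\mathcal G_l\}_{l=1}^L$ that are inactively nested in the sense that, for some $\hat l\in\{1,\dots,L\}$, $$\mathcal S_{\mathcal I,1}=\dots=\mathcal S_{\mathcal I,\hat l}\supsetneq\mathcal S_{\mathcal I,\hat l+1}\supseteq\dots\supseteq\mathcal S_{\mathcal I,L}\supsetneq\{0\}$$ (for $\hat l=L$ this reads $\mathcal S_{\mathcal I,1}=\dots=\mathcal S_{\mathcal I,L}\supsetneq\{0\}$), where $\mathcal S_{\mathcal I,l}:=\operatorname{span}\{\nabla_e^\top: e\in\mathcal I\cap\mathcal E_l\}$. Then the smallest positive eigenvalue of $\Pi_{\mathcal I}$ satisfies $\lambda_{\min>0}(\Pi_{\mathcal I})=\hat l$, and the local convergence rate constant $$\varphi:=\kappa\left(\Pi_{U(\mathcal A)}T^{-1/2}K\right)^2\cdot\kappa(G^* )$$ equals $$\varphi=\frac{L}{\hat l}\cdot\kappa(G^* ).$$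
   Context: Let $\mathcal G=(\mathcal V,\mathcal E,\omega)$ be a finite undirected weighted graph with edge weights $\omega:\mathcal E\to\mathbb{R}_{>0}$. Fix an arbitrary orientation of the edges and let $\nabla:\mathbb{R}^{\mathcal V}\to\mathbb{R}^{\mathcal E}$ be the transposed incidence matrix, $(\nabla u)_e=u_i-u_j$ for $e=(i,j)\in\mathcal E$; $\nabla_e$ denotes the row of $\nabla$ indexed by $e$, so $\nabla_e^\top\in\mathbb{R}^{\mathcal V}$. Set $K=\operatorname{diag}(\omega)\nabla$. Partition into forests: $\mathcal E=\bigsqcup_{l=1}^L\mathcal E_l$ with each $\mathcal E_l$ nonempty and each subgraph $\mathcal G_l=(\mathcal V,\mathcal E_l,\omega|_{\mathcal E_l})$ a forest. $P_l:\mathbb{R}^{\mathcal E}\to\mathbb{R}^{\mathcal E_l}$ is the restriction $P_lp=p|_{\mathcal E_l}$, $K_l=P_lK$, and $T_l=K_lK_l^\top$ (symmetric positive definite, since $\mathcal G_l$ is a forest). The preconditioner is $T:=\sum_{l=1}^LP_l^\top T_lP_l$. For the subset $\mathcal A\subseteq\mathcal E$ ("active" edges; $\mathcal I=\mathcal E\setminus\mathcal A$ are the "inactive" edges), $P_{\mathcal A}$ is the coordinate projection on $\mathbb{R}^{\mathcal E}$: $(P_{\mathcal A}p)_e=p_e$ if $e\in\mathcal A$, $0$ otherwise. $U(\mathcal A):=\ker(P_{\mathcal A}T^{-1/2})$, $\Pi_{U(\mathcal A)}$ is the orthogonal projection of $\mathbb{R}^{\mathcal E}$ onto $U(\mathcal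 A)$, and $$\Pi_{\mathcal I}:=K^\top T^{-1/2}\Pi_{U(\mathcal A)}T^{-1/2}K=K^\top T^{-1/2}\left(I-T^{-1/2}P_{\mathcal A}(T^{-1/2}P_{\mathcal A})^\dagger\right)T^{-1/2}K,$$ with $\dagger$ the Moore–Penrose pseudoinverse. $G:\mathbb{R}^{\mathcal V}\to\mathbb{R}\cup\{+\infty\}$ is proper, lower semicontinuous and convex, with Fenchel conjugate $G^*$ being $C^2$ and $l_{G^*}I\preceq\nabla^2G^*(\cdot)\preceq L_{G^*}I$ for constants $l_{G^*},L_{G^*}>0$; $\kappa(G^* ):=L_{G^*}/l_{G^*}$. For a nonzero matrix $M$, $\kappa(M)=\sigma_{\max}(M)/\sigma_{\min>0}(M)$, the ratio of its largest to its smallest positive singular value. The constant $\varphi$ is the one for which $(\varphi-1)/(\varphi+1)$ is the local linear convergence factor of the $T$-preconditioned projected gradient method for $\min_{\|p\|_\infty\le1}G^*(-K^\top p)$ when $\mathcal A$ is the active set $\{e:|p^*_e|=1\}$ at the limit point $p^*$. *)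

theory Defs
  imports "HOL-Analysis.Analysis"
begin

section \<open>Matrices\<close>

definition diag_matrix :: "('n \<Rightarrow> real) \<Rightarrow> real^'n^'n" where
  "diag_matrix d = (\<chi> i j. if i = j then d i else 0)"

definition psd_matrix :: "real^'n^'n \<Rightarrow> bool" where
  "psd_matrix M \<longleftrightarrow> transpose M = M \<and> (\<forall>x. 0 \<le> x \<bullet> (M *v x))"

definition loewner_le :: "real^'n^'n \<Rightarrow> real^'n^'n \<Rightarrow> bool" where
  "loewner_le M N \<longleftrightarrow> psd_matrix (N - M)"

text \<open>A positive semidefinite matrix has exactly one positive semidefinite square root, so the
  description below is meaningful for such matrices; likewise \<open>inv_sqrt_matrix\<close> for
  positive definite ones.\<close>

definition sqrt_matrix :: "real^'n^'n \<Rightarrow> real^'n^'n" where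
  "sqrt_matrix M = (THE R. psd_matrix R \<and> R ** R = M)"

definition inv_sqrt_matrix :: "real^'n^'n \<Rightarrow> real^'n^'n" where
  "inv_sqrt_matrix M = matrix_inv (sqrt_matrix M)"

definition eigenvalue :: "real^'n^'n \<Rightarrow> real \<Rightarrow> bool" where
  "eigenvalue M c \<longleftrightarrow> (\<exists>x. x \<noteq> 0 \<and> M *v x = c *\<^sub>R x)"

definition min_pos_eigenvalue :: "real^'n^'n \<Rightarrow> real" where
  "min_pos_eigenvalue M = Min {c. eigenvalue M c \<and> 0 < c}"

text \<open>For a wide matrix this set may contain an additional \<open>0\<close> compared with the convention
  listing only the first \<open>min m n\<close> singular values; the largest singular value and the positive
  ones do not depend on this choice.\<close>

definition singular_values :: "real^'n^'m \<Rightarrow> real set" where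
  "singular_values M = {sqrt c | c. eigenvalue (transpose M ** M) c}"

definition condition_number :: "real^'n^'m \<Rightarrow> real" where
  "condition_number M =
     Max (singular_values M) / Min {\<sigma> \<in> singular_values M. 0 < \<sigma>}"

definition orthogonal_projection :: "(real^'n) set \<Rightarrow> real^'n \<Rightarrow> real^'n" where
  "orthogonal_projection U q = (THE p. p \<in> U \<and> (\<forall>u\<in>U. orthogonal (q - p) u))"

definition projection_matrix :: "(real^'n) set \<Rightarrow> real^'n^'n" where
  "projection_matrix U = matrix (orthogonal_projection U)"

section \<open>Weighted graphs and forests\<close>

text \<open>The vertex and edge sets are the finite types \<open>'v\<close> and \<open>'e\<close>; \<open>ends e\<close> is the set of the
  two endpoints of the edge \<open>e\<close>. Parallel edges are not ruled out: the graph is simple iff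
  \<open>ends\<close> is injective.\<close>

definition undirected_graph :: "('e \<Rightarrow> 'v set) \<Rightarrow> bool" where
  "undirected_graph ends \<longleftrightarrow> (\<forall>e. card (ends e) = 2)"

definition orientation :: "('e \<Rightarrow> 'v set) \<Rightarrow> ('e \<Rightarrow> 'v) \<Rightarrow> ('e \<Rightarrow> 'v) \<Rightarrow> bool" where
  "orientation ends src dst \<longleftrightarrow> (\<forall>e. ends e = {src e, dst e})"

text \<open>A cycle is given by its distinct edges and distinct vertices in cyclic order. Its length is
  at least 3 in a simple graph; two parallel edges form a cycle of length 2.\<close>

definition graph_cycle :: "('e \<Rightarrow> 'v set) \<Rightarrow> 'e list \<Rightarrow> 'v list \<Rightarrow> bool" where
  "graph_cycle ends es vs \<longleftrightarrow>
     es \<noteq> [] \<and> length vs = length es \<and> distinct es \<and> distinct vs \<and>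
     (\<forall>k < length es. ends (es ! k) = {vs ! k, vs ! (Suc k mod length es)})"

definition is_forest :: "('e \<Rightarrow> 'v set) \<Rightarrow> 'e set \<Rightarrow> bool" where
  "is_forest ends F \<longleftrightarrow> \<not> (\<exists>es vs. set es \<subseteq> F \<and> graph_cycle ends es vs)"

definition forest_partition ::
    "('e \<Rightarrow> 'v set) \<Rightarrow> nat \<Rightarrow> (nat \<Rightarrow> 'e set) \<Rightarrow> bool" where
  "forest_partition ends L F \<longleftrightarrow>
     disjoint_family_on F {1..L} \<and> (\<Union>l\<in>{1..L}. F l) = UNIV \<and>
     (\<forall>l\<in>{1..L}. F l \<noteq> {} \<and> is_forest ends (F l))"

definition grad_matrix :: "('e \<Rightarrow> 'v) \<Rightarrow> ('e \<Rightarrow> 'v) \<Rightarrow> real^'v^'e" where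
  "grad_matrix src dst =
     (\<chi> e v. (if v = src e then 1 else 0) - (if v = dst e then 1 else 0))"

lemma grad_matrix_mult:
  fixes src dst :: "'e::finite \<Rightarrow> 'v::finite" and u :: "real^'v"
  shows "(grad_matrix src dst *v u) $ e = u $ src e - u $ dst e"
  by (simp add: grad_matrix_def matrix_vector_mult_def left_diff_distrib sum_subtractf
      if_distrib[of "\<lambda>x. x * _"] cong: if_cong)

definition weighted_grad_matrix ::
    "('e::finite \<Rightarrow> real) \<Rightarrow> ('e \<Rightarrow> 'v) \<Rightarrow> ('e \<Rightarrow> 'v) \<Rightarrow> real^'v^'e" where
  "weighted_grad_matrix \<omega> src dst = diag_matrix \<omega> ** grad_matrix src dst"

section \<open>The forest preconditioner\<close>

definition coord_proj :: "'e set \<Rightarrow> real^'e^'e" where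
  "coord_proj S = diag_matrix (indicator S)"

lemma coord_proj_mult:
  fixes p :: "real^'e::finite"
  shows "(coord_proj S *v p) $ e = (if e \<in> S then p $ e else 0)"
  by (simp add: coord_proj_def diag_matrix_def matrix_vector_mult_def indicator_def
      if_distrib[of "\<lambda>x. x * _"] cong: if_cong)

text \<open>The space of functions on an edge subset \<open>S\<close> is identified, by extension by zero, with the
  coordinate subspace of \<open>real^'e\<close> of vectors vanishing outside \<open>S\<close>. Restriction to \<open>S\<close> is then
  \<open>coord_proj S\<close>, and each summand below is the block of \<open>S = F l\<close>, placed in the full edge
  space.\<close>

definition preconditioner ::
    "real^'v^'e \<Rightarrow> nat \<Rightarrow> (nat \<Rightarrow> 'e::finite set) \<Rightarrow> real^'e^'e" where
  "preconditioner K L F =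
     (\<Sum>l=1..L. let P = coord_proj (F l); Kl = P ** K; Tl = Kl ** transpose Kl
               in transpose P ** Tl ** P)"

definition inactive_space :: "real^'e^'e \<Rightarrow> 'e set \<Rightarrow> (real^'e::finite) set" where
  "inactive_space T A = {q. (coord_proj A ** inv_sqrt_matrix T) *v q = 0}"

definition Pi_inactive ::
    "real^'v^'e \<Rightarrow> real^'e^'e \<Rightarrow> 'e::finite set \<Rightarrow> real^'v^'v" where
  "Pi_inactive K T A =
     transpose K ** inv_sqrt_matrix T ** projection_matrix (inactive_space T A)
       ** inv_sqrt_matrix T ** K"

definition edge_span ::
    "('e::finite \<Rightarrow> 'v::finite) \<Rightarrow> ('e \<Rightarrow> 'v) \<Rightarrow> 'e set \<Rightarrow> (real^'v) set" where
  "edge_span src dst S = span {row e (grad_matrix src dst) | e. e \<in> S}"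

definition inactively_nested ::
    "('e::finite \<Rightarrow> 'v::finite) \<Rightarrow> ('e \<Rightarrow> 'v) \<Rightarrow> 'e set \<Rightarrow> nat \<Rightarrow> (nat \<Rightarrow> 'e set) \<Rightarrow> nat \<Rightarrow> bool" where
  "inactively_nested src dst I L F lh \<longleftrightarrow>
     (let S = (\<lambda>l. edge_span src dst (I \<inter> F l)) in
        lh \<in> {1..L} \<and>
        (\<forall>l\<in>{1..lh}. S l = S 1) \<and>
        (lh < L \<longrightarrow> S (Suc lh) \<subset> S lh) \<and>
        (\<forall>l. lh < l \<and> l < L \<longrightarrow> S (Suc l) \<subseteq> S l) \<and>
        {0} \<subset> S L)"

section \<open>Convex functions and conjugates\<close>

definition proper_fun :: "('a \<Rightarrow> ereal) \<Rightarrow> bool" where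
  "proper_fun G \<longleftrightarrow> (\<forall>x. G x \<noteq> -\<infinity>) \<and> (\<exists>x. G x \<noteq> \<infinity>)"

definition lsc_fun :: "('a::topological_space \<Rightarrow> ereal) \<Rightarrow> bool" where
  "lsc_fun G \<longleftrightarrow> (\<forall>x. G x \<le> Liminf (at x) G)"

definition convex_fun :: "('a::real_vector \<Rightarrow> ereal) \<Rightarrow> bool" where
  "convex_fun G \<longleftrightarrow>
     (\<forall>x y t. 0 < t \<and> t < 1 \<longrightarrow>
        G ((1 - t) *\<^sub>R x + t *\<^sub>R y) \<le> ereal (1 - t) * G x + ereal t * G y)"

definition fenchel_conjugate :: "('a::real_inner \<Rightarrow> ereal) \<Rightarrow> 'a \<Rightarrow> ereal" where
  "fenchel_conjugate G y = (SUP x. ereal (x \<bullet> y) - G x)"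

definition has_hessian :: "(real^'n \<Rightarrow> real) \<Rightarrow> (real^'n \<Rightarrow> real^'n^'n) \<Rightarrow> bool" where
  "has_hessian f H \<longleftrightarrow>
     (\<exists>g. \<forall>y. (f has_derivative (\<lambda>h. g y \<bullet> h)) (at y) \<and>
              (g has_derivative (\<lambda>h. H y *v h)) (at y))"

definition C2_hessian_bounds :: "(real^'n \<Rightarrow> ereal) \<Rightarrow> real \<Rightarrow> real \<Rightarrow> bool" where
  "C2_hessian_bounds f l u \<longleftrightarrow>
     (\<forall>y. \<bar>f y\<bar> \<noteq> \<infinity>) \<and>
     (\<exists>H. has_hessian (\<lambda>y. real_of_ereal (f y)) H \<and> continuous_on UNIV H \<and>
          (\<forall>y. loewner_le (l *\<^sub>R mat 1) (H y) \<and> loewner_le (H y) (u *\<^sub>R mat 1)))"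

text \<open>Here \<open>lG\<close> and \<open>LG\<close> are the given lower and upper Hessian bounds of the conjugate, whose
  condition number is by definition their quotient.\<close>

definition rate_constant ::
    "real^'v^'e \<Rightarrow> real^'e^'e \<Rightarrow> 'e::finite set \<Rightarrow> real \<Rightarrow> real \<Rightarrow> real" where
  "rate_constant K T A lG LG =
     (condition_number (projection_matrix (inactive_space T A) ** inv_sqrt_matrix T ** K))\<^sup>2
       * (LG / lG)"

end

theory Submission
  imports Defs
begin

text \<open>The matrix \<open>\<Pi>\<^sub>I\<close> is a sum of orthogonal projections. The preconditioner \<open>T\<close> does not couple
  different forests. After the substitution \<open>p = T\<^sup>1\<^sup>/\<^sup>2 q\<close>, the projection onto \<open>U(A)\<close>
  becomes the problem of finding \<open>q\<close> supported on the inactive edges with \<open>T q = K x\<close> on these edges.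
  This splits into one set of normal equations per forest, and the solution in forest \<open>l\<close> contributes
  the orthogonal projection of \<open>x\<close> onto \<open>S\<^sub>l\<close>, the span of the gradient rows of the inactive edges of
  that forest. Hence \<open>\<Pi>\<^sub>I x = \<Sum>\<^sub>l P\<^sub>l x\<close>, where \<open>P\<^sub>l\<close> projects onto \<open>S\<^sub>l\<close>
  (\<open>Pi_inactive_preconditioner_mult\<close>).

  Since the subspaces form a decreasing chain, this sum multiplies a vector of \<open>S\<^sub>k\<close> that is orthogonal
  to \<open>S\<^sub>k\<^sub>+\<^sub>1\<close> by \<open>k\<close>, and it annihilates the complement of \<open>S\<^sub>1\<close>. The positive eigenvalues are the
  indices \<open>k\<close> at which the chain drops, the space after the last one being \<open>{0}\<close>. The first drop
  occurs at \<open>lh\<close> and the last at \<open>L\<close>, so these are the smallest and the largest positive eigenvalue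
  (locale \<open>nested_projections\<close>). As \<open>\<Pi>\<^sub>I\<close> is the Gram matrix of \<open>\<Pi>\<^sub>U T\<^sup>-\<^sup>1\<^sup>/\<^sup>2 K\<close>
  (\<open>Pi_inactive_gram\<close>), the squared condition number of the latter is \<open>L / lh\<close>.

  For \<open>T\<^sup>-\<^sup>1\<^sup>/\<^sup>2\<close> to be meaningful, positive semidefinite matrices must have unique
  positive semidefinite square roots, which rests on the spectral theorem
  (\<open>symmetric_matrix_eigenbasis\<close>), and \<open>T\<close> must be definite, because the gradient rows of a forest are
  linearly independent: a forest has a leaf, and the row of the leaf edge is the only one that is
  nonzero at the leaf vertex.\<close>

section \<open>Square roots of positive semidefinite matrices\<close>

lemma inner_matrix_vector_transpose:
  fixes M :: "real^'n^'m"
  shows "x \<bullet> (M *v y) = (transpose M *v x) \<bullet> y"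
  by (simp add: dot_lmul_matrix)

text \<open>Where a form that is nonnegative on a subspace vanishes, it attains its minimum, so its
  derivative in every direction of the subspace vanishes as well. Here \<open>t\<close> is the step that makes
  the quadratic in \<open>t\<close> negative if the linear coefficient \<open>a\<close> is nonzero; dividing by \<open>c + 1\<close> rather
  than \<open>c\<close> avoids a separate case for \<open>c = 0\<close>.\<close>

lemma nonneg_form_isotropic_vector:
  fixes M :: "real^'n^'n"
  assumes sym: "transpose M = M" and V: "subspace V"
    and pos: "\<And>x. x \<in> V \<Longrightarrow> 0 \<le> x \<bullet> (M *v x)"
    and x: "x \<in> V" "x \<bullet> (M *v x) = 0" and h: "h \<in> V"
  shows "h \<bullet> (M *v x) = 0"
proof (rule ccontr)
  define a where "a = h \<bullet> (M *v x)"
  define c where "c = h \<bullet> (M *v h)"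
  assume "h \<bullet> (M *v x) \<noteq> 0"
  hence a: "a \<noteq> 0" by (simp add: a_def)
  have c0: "0 \<le> c" using pos[OF h] by (simp add: c_def)
  have sw: "x \<bullet> (M *v h) = a"
    by (metis a_def inner_commute inner_matrix_vector_transpose sym)
  have q: "0 \<le> 2 * t * a + t\<^sup>2 * c" for t
  proof -
    have "x + t *\<^sub>R h \<in> V" using V x h by (simp add: subspace_add subspace_scale)
    from pos[OF this] show ?thesis
      by (simp add: matrix_vector_right_distrib matrix_vector_mult_scaleR inner_add_left
          inner_add_right x sw a_def[symmetric] c_def[symmetric] power2_eq_square algebra_simps)
  qed
  define t where "t = - a / (c + 1)"
  have at: "a = - t * (c + 1)" using c0 by (simp add: t_def)
  have "2 * t * a + t\<^sup>2 * c = - (t\<^sup>2 * (c + 2))"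
    unfolding at by (simp add: power2_eq_square algebra_simps)
  moreover have "t\<^sup>2 * (c + 2) > 0" using a at c0 by simp
  ultimately show False using q[of t] by linarith
qed

text \<open>The Rayleigh quotient attains its maximum \<open>c\<close> on the unit sphere of the subspace. There the
  form of \<open>c I - M\<close> is nonnegative and vanishes at the maximizer \<open>x\<close>, so \<open>c x - M x\<close>, which lies in the
  subspace, is orthogonal to the subspace and hence to itself.\<close>

lemma symmetric_matrix_eigenvector_in_subspace:
  fixes M :: "real^'n^'n"
  assumes sym: "transpose M = M" and V: "subspace V" and inv: "\<And>x. x \<in> V \<Longrightarrow> M *v x \<in> V"
    and ne: "V \<noteq> {0}"
  obtains x c where "x \<in> V" "norm x = 1" "M *v x = c *\<^sub>R x"
proof -
  let ?S = "sphere 0 1 \<inter> V"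
  have "0 \<in> V" using V by (rule subspace_0)
  then obtain v where v: "v \<in> V" "v \<noteq> 0" using ne by blast
  hence "(1 / norm v) *\<^sub>R v \<in> ?S" using V by (auto simp: subspace_scale)
  hence S_ne: "?S \<noteq> {}" by blast
  have "compact ?S" using V by (intro compact_Int_closed closed_subspace) auto
  moreover have "continuous_on ?S (\<lambda>x. x \<bullet> (M *v x))"
    by (intro continuous_intros linear_continuous_on linear_conv_bounded_linear[THEN iffD1]
        matrix_vector_mul_linear)
  ultimately obtain x where x: "x \<in> ?S" and max: "\<And>y. y \<in> ?S \<Longrightarrow> y \<bullet> (M *v y) \<le> x \<bullet> (M *v x)"
    using continuous_attains_sup[OF _ S_ne] by blast
  define c where "c = x \<bullet> (M *v x)"
  define N where "N = c *\<^sub>R mat 1 - M"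
  have N: "N *v y = c *\<^sub>R y - M *v y" for y
    by (simp add: N_def matrix_vector_mult_diff_rdistrib scaleR_matrix_vector_assoc[symmetric])
  have xx: "x \<bullet> x = 1" using x by (simp add: dot_square_norm)
  have pos: "0 \<le> y \<bullet> (N *v y)" if y: "y \<in> V" for y
  proof (cases "y = 0")
    case False
    let ?z = "(1 / norm y) *\<^sub>R y"
    have "?z \<in> ?S" using False y V by (auto simp: subspace_scale)
    hence "?z \<bullet> (M *v ?z) \<le> c" unfolding c_def by (rule max)
    moreover have "?z \<bullet> (M *v ?z) = (y \<bullet> (M *v y)) / (norm y)\<^sup>2"
      by (simp add: matrix_vector_mult_scaleR power2_eq_square)
    ultimately have "(y \<bullet> (M *v y)) / (norm y)\<^sup>2 \<le> c" by linarith
    hence "y \<bullet> (M *v y) \<le> c * (norm y)\<^sup>2" using False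
      by (simp only: pos_divide_le_eq zero_less_power zero_less_norm_iff not_False_eq_True)
    thus ?thesis by (simp add: N inner_diff_right dot_square_norm)
  qed simp
  have symN: "transpose N = N"
    using sym by (simp add: N_def transpose_def mat_def vec_eq_iff)
  have x0: "x \<bullet> (N *v x) = 0" by (simp add: N inner_diff_right xx c_def)
  have NxV: "N *v x \<in> V" using x V inv by (auto simp: N intro: subspace_diff subspace_scale)
  have "(N *v x) \<bullet> (N *v x) = 0"
    using nonneg_form_isotropic_vector[OF symN V pos _ x0 NxV] x by blast
  hence "M *v x = c *\<^sub>R x" by (simp add: N)
  thus ?thesis using that x by auto
qed

definition orthonormal_eigenvectors :: "real^'n^'n \<Rightarrow> (real^'n) set \<Rightarrow> bool" where
  "orthonormal_eigenvectors M B \<longleftrightarrow>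
     pairwise orthogonal B \<and> (\<forall>b\<in>B. norm b = 1 \<and> (\<exists>c. M *v b = c *\<^sub>R b))"

text \<open>An orthonormal family of eigenvectors of maximal size spans everything: its orthogonal
  complement is invariant under a symmetric matrix, so if it were nonzero it would contain a further
  unit eigenvector.\<close>

lemma symmetric_matrix_eigenbasis:
  fixes M :: "real^'n^'n"
  assumes sym: "transpose M = M"
  obtains B where "finite B" "orthonormal_eigenvectors M B" "span B = UNIV"
proof -
  have bound: "finite B \<and> card B \<le> CARD('n)" if "orthonormal_eigenvectors M B" for B
  proof -
    have "0 \<notin> B" using that by (auto simp: orthonormal_eigenvectors_def)
    hence "independent B"
      using that pairwise_orthogonal_independent by (auto simp: orthonormal_eigenvectors_def)
    thus ?thesis using independent_bound[of B] by simp
  qed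
  have "orthonormal_eigenvectors M {}" by (simp add: orthonormal_eigenvectors_def)
  moreover have "\<forall>B. orthonormal_eigenvectors M B \<longrightarrow> card B < Suc CARD('n)"
    using bound by (simp add: less_Suc_eq_le)
  ultimately obtain B where B: "orthonormal_eigenvectors M B"
    and max: "\<And>B'. orthonormal_eigenvectors M B' \<Longrightarrow> card B' \<le> card B"
    using ex_has_greatest_nat[of "orthonormal_eigenvectors M" "{}" card "Suc CARD('n)"] by blast
  have "span B = UNIV"
  proof (rule ccontr)
    assume notall: "span B \<noteq> UNIV"
    define V where "V = {x. \<forall>b\<in>B. orthogonal b x}"
    have V: "subspace V" unfolding V_def by (rule subspace_orthogonal_to_vectors)
    have inv: "M *v x \<in> V" if "x \<in> V" for x
    proof -
      have "b \<bullet> (M *v x) = 0" if bB: "b \<in> B" for b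
      proof -
        obtain c where "M *v b = c *\<^sub>R b"
          using B bB unfolding orthonormal_eigenvectors_def by blast
        thus ?thesis using bB \<open>x \<in> V\<close> inner_matrix_vector_transpose[of b M x] sym
          by (simp add: V_def orthogonal_def)
      qed
      thus ?thesis by (simp add: V_def orthogonal_def)
    qed
    have "span B \<subset> span UNIV" using notall by auto
    then obtain v where "v \<noteq> 0" "\<And>y. y \<in> span B \<Longrightarrow> orthogonal v y"
      using orthogonal_to_subspace_exists_gen[of B UNIV] by blast
    hence "v \<in> V" "v \<noteq> 0" by (auto simp: V_def span_base orthogonal_commute)
    hence "V \<noteq> {0}" by blast
    then obtain x c where x: "x \<in> V" "norm x = 1" "M *v x = c *\<^sub>R x"
      using symmetric_matrix_eigenvector_in_subspace[OF sym V inv] by metis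
    have "x \<notin> B" using x by (auto simp: V_def orthogonal_self)
    moreover have "orthonormal_eigenvectors M (insert x B)"
      using B x by (auto simp: orthonormal_eigenvectors_def pairwise_insert V_def orthogonal_commute)
    ultimately show False using max[of "insert x B"] bound[OF B] by simp
  qed
  thus ?thesis using that B bound by blast
qed

lemma orthonormal_expansion:
  fixes x :: "real^'n"
  assumes fin: "finite B" and B: "pairwise orthogonal B" "\<And>b. b \<in> B \<Longrightarrow> norm b = 1"
    and sp: "span B = UNIV"
  shows "(\<Sum>b\<in>B. (b \<bullet> x) *\<^sub>R b) = x"
  using orthonormal_basis_expand[OF B _ fin, of x] sp by (simp add: inner_commute)

text \<open>The root has the same eigenbasis as \<open>M\<close>, with the square roots of the eigenvalues.\<close>

lemma psd_matrix_sqrt_exists: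
  fixes M :: "real^'n^'n"
  assumes M: "psd_matrix M"
  shows "\<exists>R. psd_matrix R \<and> R ** R = M"
proof -
  have sym: "transpose M = M" using M by (simp add: psd_matrix_def)
  obtain B where fin: "finite B" and B: "orthonormal_eigenvectors M B" and sp: "span B = UNIV"
    using symmetric_matrix_eigenbasis[OF sym] .
  have orth: "pairwise orthogonal B" and nrm: "\<And>b. b \<in> B \<Longrightarrow> norm b = 1"
    using B by (auto simp: orthonormal_eigenvectors_def)
  obtain \<mu> where \<mu>: "\<And>b. b \<in> B \<Longrightarrow> M *v b = \<mu> b *\<^sub>R b"
    using B unfolding orthonormal_eigenvectors_def by metis
  have \<mu>_nonneg: "0 \<le> \<mu> b" if "b \<in> B" for b
  proof -
    have "0 \<le> b \<bullet> (M *v b)" using M by (simp add: psd_matrix_def)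
    thus ?thesis using \<mu> nrm that by (simp add: dot_square_norm)
  qed
  have ip: "b \<bullet> b' = (if b = b' then 1 else 0)" if "b \<in> B" "b' \<in> B" for b b'
    using orth nrm that by (auto simp: pairwise_def orthogonal_def dot_square_norm)
  define f where "f x = (\<Sum>b\<in>B. (sqrt (\<mu> b) * (b \<bullet> x)) *\<^sub>R b)" for x
  have lin: "linear f"
    unfolding f_def
    by (intro linear_compose_sum ballI linearI) (simp_all add: inner_add_right algebra_simps)
  let ?R = "matrix f"
  have R: "?R *v x = f x" for x by (rule fun_cong[OF matrix_vector_mul(2)[OF lin]])
  have fb: "b \<bullet> f x = sqrt (\<mu> b) * (b \<bullet> x)" if "b \<in> B" for b x
  proof -
    have "b \<bullet> f x = (\<Sum>b'\<in>B. (if b' = b then sqrt (\<mu> b) * (b \<bullet> x) else 0))"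
      unfolding f_def inner_sum_right using that by (intro sum.cong) (auto simp: ip)
    thus ?thesis using fin that by simp
  qed
  have "(?R ** ?R) *v x = M *v x" for x
  proof -
    have "(?R ** ?R) *v x = (\<Sum>b\<in>B. (b \<bullet> x) *\<^sub>R (M *v b))"
      unfolding matrix_vector_mul_assoc[symmetric] R
      by (subst f_def) (auto intro!: sum.cong simp: fb \<mu> \<mu>_nonneg mult.assoc[symmetric])
    also have "\<dots> = M *v (\<Sum>b\<in>B. (b \<bullet> x) *\<^sub>R b)"
      by (simp add: linear_sum[OF matrix_vector_mul_linear] matrix_vector_mult_scaleR)
    finally show ?thesis by (simp add: orthonormal_expansion[OF fin orth nrm sp])
  qed
  hence "?R ** ?R = M" by (simp add: matrix_eq)
  moreover have "psd_matrix ?R"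
  proof -
    have fxy: "y \<bullet> f x = (\<Sum>b\<in>B. sqrt (\<mu> b) * (b \<bullet> x) * (b \<bullet> y))" for x y
      by (simp add: f_def inner_sum_right inner_commute[of y])
    have "(transpose ?R *v y) \<bullet> x = (?R *v y) \<bullet> x" for x y
      unfolding inner_matrix_vector_transpose[symmetric] R
      by (subst (2) inner_commute) (simp add: fxy mult_ac)
    hence "transpose ?R *v y = ?R *v y" for y using vector_eq_rdot by blast
    hence "transpose ?R = ?R" by (simp only: matrix_eq simp_thms)
    moreover have "0 \<le> x \<bullet> (?R *v x)" for x
      unfolding R fxy by (intro sum_nonneg) (simp add: \<mu>_nonneg mult.assoc)
    ultimately show ?thesis by (simp add: psd_matrix_def)
  qed
  ultimately show ?thesis by blast
qed

text \<open>With \<open>D = R - S\<close>, the equality of the squares gives \<open>R D + D S = 0\<close>. Pairing this with a unit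
  eigenvector \<open>b\<close> of \<open>D\<close> for \<open>c\<close> gives \<open>c (b \<bullet> R b + b \<bullet> S b) = 0\<close>. Both forms are nonnegative and
  their difference is \<open>c\<close>, so \<open>c = 0\<close>. Thus \<open>D\<close> vanishes on an eigenbasis.\<close>

lemma psd_matrix_sqrt_unique:
  fixes R S :: "real^'n^'n"
  assumes R: "psd_matrix R" and S: "psd_matrix S" and eq: "R ** R = S ** S"
  shows "R = S"
proof -
  define D where "D = R - S"
  have symR: "transpose R = R" and symS: "transpose S = S"
    using R S by (auto simp: psd_matrix_def)
  have symD: "transpose D = D"
    using symR symS by (simp add: D_def transpose_def vec_eq_iff)
  have D: "D *v x = R *v x - S *v x" for x by (simp add: D_def matrix_vector_mult_diff_rdistrib)
  obtain B where fin: "finite B" and B: "orthonormal_eigenvectors D B" and sp: "span B = UNIV"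
    using symmetric_matrix_eigenbasis[OF symD] .
  have "D *v b = 0" if bB: "b \<in> B" for b
  proof -
    obtain c where c: "D *v b = c *\<^sub>R b" and "norm b = 1"
      using B bB unfolding orthonormal_eigenvectors_def by blast
    hence b: "b \<bullet> b = 1" by (simp add: dot_square_norm)
    have "R *v (R *v b) = S *v (S *v b)" using eq by (simp add: matrix_vector_mul_assoc)
    moreover have "R *v (D *v b) + D *v (S *v b) = R *v (R *v b) - S *v (S *v b)"
      by (simp add: D matrix_vector_mult_diff_distrib)
    ultimately have "b \<bullet> (R *v (D *v b)) + b \<bullet> (D *v (S *v b)) = 0"
      by (simp add: inner_add_right[symmetric])
    moreover have "b \<bullet> (R *v (D *v b)) = c * (b \<bullet> (R *v b))"
      by (simp add: c matrix_vector_mult_scaleR)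
    moreover have "b \<bullet> (D *v (S *v b)) = c * (b \<bullet> (S *v b))"
      using inner_matrix_vector_transpose[of b D "S *v b"] unfolding symD c by simp
    ultimately have "c * (b \<bullet> (R *v b) + b \<bullet> (S *v b)) = 0" by (simp add: distrib_left)
    moreover have "b \<bullet> (R *v b) \<ge> 0" "b \<bullet> (S *v b) \<ge> 0" using R S by (auto simp: psd_matrix_def)
    moreover have "b \<bullet> (R *v b) - b \<bullet> (S *v b) = c"
      using arg_cong[OF c, of "inner b"] b by (simp add: D inner_diff_right)
    ultimately have "c = 0" by (auto simp: add_nonneg_eq_0_iff)
    thus ?thesis using c by simp
  qed
  moreover have "linear ((*v) D)" "linear (\<lambda>x. 0)" by (auto intro: linearI)
  ultimately have "D *v x = 0" for x
    using linear_eq_on[of "(*v) D" "\<lambda>_. 0" x B] sp by blast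
  hence "D = 0" by (simp add: matrix_eq)
  thus ?thesis by (simp add: D_def)
qed

lemma sqrt_matrix:
  assumes "psd_matrix M"
  shows "psd_matrix (sqrt_matrix M) \<and> sqrt_matrix M ** sqrt_matrix M = M"
proof -
  have "\<exists>!R. psd_matrix R \<and> R ** R = M"
    using psd_matrix_sqrt_exists[OF assms] psd_matrix_sqrt_unique by blast
  thus ?thesis unfolding sqrt_matrix_def by (rule theI')
qed

definition pd_matrix :: "real^'n^'n \<Rightarrow> bool" where
  "pd_matrix M \<longleftrightarrow> psd_matrix M \<and> (\<forall>x. x \<bullet> (M *v x) = 0 \<longrightarrow> x = 0)"

lemma inv_sqrt_matrix:
  fixes M :: "real^'n^'n"
  assumes pd: "pd_matrix M"
  shows "transpose (inv_sqrt_matrix M) = inv_sqrt_matrix M"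
    and "inv_sqrt_matrix M *v (sqrt_matrix M *v x) = x"
    and "sqrt_matrix M *v (inv_sqrt_matrix M *v x) = x"
proof -
  let ?R = "sqrt_matrix M"
  have R: "psd_matrix ?R" "?R ** ?R = M" using sqrt_matrix pd by (auto simp: pd_matrix_def)
  have "x = 0" if "?R *v x = 0" for x
  proof -
    have "M *v x = ?R *v (?R *v x)" by (simp only: R(2) matrix_vector_mul_assoc)
    thus ?thesis using that pd by (simp add: pd_matrix_def)
  qed
  hence "\<exists>S. S ** ?R = mat 1" using matrix_left_invertible_ker[of ?R] by blast
  hence "\<exists>S. ?R ** S = mat 1 \<and> S ** ?R = mat 1" using matrix_left_right_inverse by blast
  from someI_ex[OF this]
  have inv: "?R ** inv_sqrt_matrix M = mat 1" "inv_sqrt_matrix M ** ?R = mat 1"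
    by (simp_all add: inv_sqrt_matrix_def matrix_inv_def)
  thus "inv_sqrt_matrix M *v (?R *v x) = x" "?R *v (inv_sqrt_matrix M *v x) = x"
    by (simp_all add: matrix_vector_mul_assoc)
  have "transpose (inv_sqrt_matrix M) ** ?R = mat 1"
    using arg_cong[OF inv(1), of transpose] R(1) by (simp add: matrix_transpose_mul psd_matrix_def)
  hence "(transpose (inv_sqrt_matrix M) ** ?R) ** inv_sqrt_matrix M = inv_sqrt_matrix M" by simp
  thus "transpose (inv_sqrt_matrix M) = inv_sqrt_matrix M"
    by (simp only: matrix_mul_assoc[symmetric] inv matrix_mul_rid)
qed

section \<open>Orthogonal projections\<close>

lemma orthogonal_projection_eqI:
  assumes U: "subspace U" and p: "p \<in> U" "\<And>u. u \<in> U \<Longrightarrow> orthogonal (q - p) u"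
  shows "orthogonal_projection U q = p"
  unfolding orthogonal_projection_def
proof (rule the_equality)
  show "p \<in> U \<and> (\<forall>u\<in>U. orthogonal (q - p) u)" using p by blast
next
  fix p' assume p': "p' \<in> U \<and> (\<forall>u\<in>U. orthogonal (q - p') u)"
  have "p - p' \<in> U" using U p p' by (simp add: subspace_diff)
  hence "(q - p) \<bullet> (p - p') = 0" "(q - p') \<bullet> (p - p') = 0"
    using p p' by (auto simp: orthogonal_def)
  hence "(p - p') \<bullet> (p - p') = 0" by (simp add: inner_diff_left)
  thus "p' = p" by simp
qed

lemma orthogonal_projection:
  fixes U :: "(real^'n) set"
  assumes U: "subspace U"
  shows orthogonal_projection_in: "orthogonal_projection U q \<in> U"
    and orthogonal_projection_residual: "u \<in> U \<Longrightarrow> (q - orthogonal_projection U q) \<bullet> u = 0"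
proof -
  obtain y z where yz: "y \<in> span U" "\<And>w. w \<in> span U \<Longrightarrow> orthogonal z w" "q = y + z"
    using orthogonal_subspace_decomp_exists[of U q] by blast
  have sp: "span U = U" using U by simp
  have eq: "orthogonal_projection U q = y"
    using yz sp by (intro orthogonal_projection_eqI[OF U]) auto
  show "orthogonal_projection U q \<in> U" using eq yz sp by simp
  show "(q - orthogonal_projection U q) \<bullet> u = 0" if "u \<in> U"
    using eq yz sp that by (auto simp: orthogonal_def)
qed

lemma linear_orthogonal_projection:
  fixes U :: "(real^'n) set"
  assumes U: "subspace U"
  shows "linear (orthogonal_projection U)"
proof (rule linearI)
  note pr = orthogonal_projection_in[OF U] orthogonal_projection_residual[OF U]
  fix x y :: "real^'n" and c :: real
  show "orthogonal_projection U (x + y) = orthogonal_projection U x + orthogonal_projection U y"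
  proof (rule orthogonal_projection_eqI[OF U])
    fix u assume "u \<in> U"
    thus "orthogonal (x + y - (orthogonal_projection U x + orthogonal_projection U y)) u"
      using pr(2)[of u x] pr(2)[of u y]
      by (simp add: orthogonal_def inner_diff_left inner_add_left)
  qed (simp add: U subspace_add pr)
  show "orthogonal_projection U (c *\<^sub>R x) = c *\<^sub>R orthogonal_projection U x"
  proof (rule orthogonal_projection_eqI[OF U])
    fix u assume "u \<in> U"
    thus "orthogonal (c *\<^sub>R x - c *\<^sub>R orthogonal_projection U x) u"
      using pr(2)[of u x] by (simp add: orthogonal_def scaleR_diff_right[symmetric])
  qed (simp add: U subspace_scale pr)
qed

lemma orthogonal_projection_ident:
  "subspace U \<Longrightarrow> x \<in> U \<Longrightarrow> orthogonal_projection U x = x"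
  by (rule orthogonal_projection_eqI) (auto simp: orthogonal_def)

lemma orthogonal_projection_of_orthogonal:
  "subspace U \<Longrightarrow> (\<And>u. u \<in> U \<Longrightarrow> x \<bullet> u = 0) \<Longrightarrow> orthogonal_projection U x = 0"
  by (rule orthogonal_projection_eqI) (auto simp: orthogonal_def subspace_0)

lemma orthogonal_projection_eq_0_mono:
  fixes x :: "real^'n"
  assumes U: "subspace U" and V: "subspace V" and sub: "U \<subseteq> V"
    and z: "orthogonal_projection V x = 0"
  shows "orthogonal_projection U x = 0"
proof (rule orthogonal_projection_of_orthogonal[OF U])
  fix u assume "u \<in> U"
  thus "x \<bullet> u = 0" using orthogonal_projection_residual[OF V, of u x] sub z by auto
qed

text \<open>The difference \<open>x - P\<^sub>V x\<close> is orthogonal to \<open>V\<close>, hence to \<open>U\<close>.\<close>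

lemma orthogonal_projection_nested:
  fixes x :: "real^'n"
  assumes U: "subspace U" and V: "subspace V" and sub: "U \<subseteq> V"
  shows "orthogonal_projection U (orthogonal_projection V x) = orthogonal_projection U x"
proof -
  have "orthogonal_projection U (x - orthogonal_projection V x) = 0"
    using orthogonal_projection_residual[OF V] sub
    by (intro orthogonal_projection_of_orthogonal[OF U]) blast
  thus ?thesis by (simp add: linear_diff[OF linear_orthogonal_projection[OF U]])
qed

lemma projection_matrix_mult:
  fixes U :: "(real^'n) set"
  assumes "subspace U"
  shows "projection_matrix U *v x = orthogonal_projection U x"
  unfolding projection_matrix_def
  by (rule fun_cong[OF matrix_vector_mul(2)[OF linear_orthogonal_projection[OF assms]]])

lemma projection_matrix_gram:
  fixes U :: "(real^'n) set"
  assumes U: "subspace U"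
  shows "transpose (projection_matrix U) ** projection_matrix U = projection_matrix U"
proof -
  let ?P = "projection_matrix U"
  have "(transpose ?P *v (?P *v x)) \<bullet> y = (?P *v x) \<bullet> y" for x y
  proof -
    have "(transpose ?P *v (?P *v x)) \<bullet> y = (?P *v x) \<bullet> (?P *v y)"
      by (rule inner_matrix_vector_transpose[symmetric])
    also have "\<dots> = (?P *v x) \<bullet> y"
      using orthogonal_projection_residual[OF U, of "orthogonal_projection U x" y]
        orthogonal_projection_in[OF U, of x]
      by (simp add: projection_matrix_mult[OF U] inner_diff_left inner_diff_right inner_commute)
    finally show ?thesis .
  qed
  hence "transpose ?P *v (?P *v x) = ?P *v x" for x using vector_eq_rdot by blast
  thus ?thesis by (simp only: matrix_eq matrix_vector_mul_assoc simp_thms)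
qed

section \<open>Forests\<close>

text \<open>Take the first time \<open>j\<close> at which the walk returns to an earlier vertex \<open>v i\<close>; the portion from \<open>i\<close>
  to \<open>j\<close> is a cycle. Its vertices are distinct by the choice of \<open>j\<close>. If two of its edges agreed, the
  distinctness of the vertices would force them to be consecutive, which the absence of backtracking
  excludes. This also covers parallel edges, where the cycle has length 2.\<close>

lemma nonbacktracking_walk_gives_cycle:
  fixes ends :: "'e \<Rightarrow> 'v::finite set" and v :: "nat \<Rightarrow> 'v" and e :: "nat \<Rightarrow> 'e"
  assumes graph: "undirected_graph ends"
    and ends: "\<And>n. ends (e n) = {v n, v (Suc n)}"
    and nb: "\<And>n. e (Suc n) \<noteq> e n"
  obtains es vs where "set es \<subseteq> range e" "graph_cycle ends es vs"
proof -
  have vne: "v n \<noteq> v (Suc n)" for n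
  proof
    assume "v n = v (Suc n)"
    hence "card (ends (e n)) = 1" using ends by simp
    thus False using graph by (simp add: undirected_graph_def)
  qed
  have "\<not> inj v" using finite_imageD[of v UNIV] by auto
  then obtain a b where "v a = v b" "a \<noteq> b" unfolding inj_def by blast
  hence ex: "\<exists>j. \<exists>i<j. v i = v j" by (cases a b rule: linorder_cases) metis+
  define j where "j = (LEAST j. \<exists>i<j. v i = v j)"
  have j: "\<exists>i<j. v i = v j" unfolding j_def using ex by (rule LeastI_ex)
  have least: "v i' \<noteq> v j'" if "j' < j" "i' < j'" for i' j'
    using not_less_Least[of j' "\<lambda>j. \<exists>i<j. v i = v j"] that unfolding j_def by blast
  obtain i where i: "i < j" "v i = v j" using j by blast
  have inj: "a = b" if "v a = v b" "a < j" "b < j" for a b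
    using least[of b a] least[of a b] that by (cases a b rule: linorder_cases) auto
  define m where "m = j - i"
  have m: "0 < m" "j = i + m" using i by (auto simp: m_def)
  have e_inj: False if ab: "a < b" "b < j" "i \<le> a" and eq: "e a = e b" for a b
  proof -
    have "{v a, v (Suc a)} = {v b, v (Suc b)}" using ends eq by metis
    moreover have "v a \<noteq> v b" using inj[of a b] ab by auto
    ultimately have *: "v a = v (Suc b)" "v b = v (Suc a)" by (auto simp: doubleton_eq_iff)
    have "b = Suc a" using inj[OF *(2)] ab by linarith
    thus False using nb eq by metis
  qed
  let ?es = "map e [i..<j]" and ?vs = "map v [i..<j]"
  have "inj_on e {i..<j}"
  proof (rule inj_onI)
    fix a b assume "a \<in> {i..<j}" "b \<in> {i..<j}" "e a = e b"
    thus "a = b" using e_inj[of a b] e_inj[of b a] by (cases a b rule: linorder_cases) auto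
  qed
  hence "distinct ?es" by (simp add: distinct_map)
  moreover have "distinct ?vs"
    unfolding distinct_map using inj by (auto simp: inj_on_def)
  moreover have "ends (?es ! k) = {?vs ! k, ?vs ! (Suc k mod length ?es)}" if "k < length ?es" for k
  proof (cases "Suc k < m")
    case True
    thus ?thesis using m ends[of "i + k"] by simp
  next
    case False
    hence k: "Suc k = m" using that m by simp
    hence "Suc (i + k) = j" using m by auto
    hence "{v (i + k), v (Suc (i + k))} = {?vs ! k, ?vs ! 0}" using i by simp
    moreover have "Suc k mod length ?es = 0" using k by (simp add: m_def)
    moreover have "?es ! k = e (i + k)" using that by simp
    ultimately show ?thesis using ends[of "i + k"] by simp
  qed
  ultimately have "graph_cycle ends ?es ?vs" using i by (simp add: graph_cycle_def)
  thus ?thesis by (intro that[of ?es ?vs]) auto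
qed

text \<open>If every endpoint of an edge in \<open>S\<close> met a second edge of \<open>S\<close>, one could walk along \<open>S\<close> forever
  without backtracking, and so find a cycle. A state of the walk is an edge together with the
  endpoint through which it is entered.\<close>

lemma forest_has_leaf:
  fixes ends :: "'e \<Rightarrow> 'v::finite set"
  assumes graph: "undirected_graph ends" and forest: "is_forest ends F"
    and S: "S \<subseteq> F" "S \<noteq> {}"
  shows "\<exists>e\<in>S. \<exists>w\<in>ends e. \<forall>e'\<in>S. w \<in> ends e' \<longrightarrow> e' = e"
proof (rule ccontr)
  assume no: "\<not> ?thesis"
  have next_edge: "\<exists>e'\<in>S. e' \<noteq> e \<and> w \<in> ends e'" if "e \<in> S" "w \<in> ends e" for e w
    using no that by blast
  have other: "\<exists>w. ends e = {u, w}" if "u \<in> ends e" for e u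
  proof -
    have "card (ends e) = 2" using graph by (simp add: undirected_graph_def)
    then obtain a b where "ends e = {a, b}" by (auto simp: card_2_iff)
    thus ?thesis using that by auto
  qed
  obtain e0 where e0: "e0 \<in> S" using S by blast
  have "card (ends e0) = 2" using graph by (simp add: undirected_graph_def)
  hence "ends e0 \<noteq> {}" by auto
  then obtain u0 where u0: "u0 \<in> ends e0" by blast
  have "\<exists>f. \<forall>n. (fst (f n) \<in> S \<and> snd (f n) \<in> ends (fst (f n))) \<and>
      (fst (f (Suc n)) \<noteq> fst (f n) \<and> ends (fst (f n)) = {snd (f n), snd (f (Suc n))})"
  proof (rule dependent_nat_choice)
    show "\<exists>x. fst x \<in> S \<and> snd x \<in> ends (fst x)" using e0 u0 by (intro exI[of _ "(e0, u0)"]) simp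
  next
    fix x :: "'e \<times> 'v" and n :: nat
    assume x: "fst x \<in> S \<and> snd x \<in> ends (fst x)"
    then obtain w where w: "ends (fst x) = {snd x, w}" using other by blast
    then obtain e' where "e' \<in> S" "e' \<noteq> fst x" "w \<in> ends e'" using next_edge x by blast
    thus "\<exists>y. (fst y \<in> S \<and> snd y \<in> ends (fst y)) \<and>
        (fst y \<noteq> fst x \<and> ends (fst x) = {snd x, snd y})"
      using w by (intro exI[of _ "(e', w)"]) simp
  qed
  then obtain f where f: "\<And>n. fst (f n) \<in> S" "\<And>n. fst (f (Suc n)) \<noteq> fst (f n)"
      "\<And>n. ends (fst (f n)) = {snd (f n), snd (f (Suc n))}" by blast
  obtain es vs where "set es \<subseteq> range (\<lambda>n. fst (f n))" "graph_cycle ends es vs"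
    using nonbacktracking_walk_gives_cycle[of ends "\<lambda>n. fst (f n)" "\<lambda>n. snd (f n)"] graph f
    by blast
  moreover have "range (\<lambda>n. fst (f n)) \<subseteq> F" using f(1) S by auto
  ultimately show False using forest unfolding is_forest_def by blast
qed

section \<open>Gradient rows of a forest\<close>

lemma transpose_mult_eq_sum_rows:
  fixes K :: "real^'v^'e"
  shows "transpose K *v p = (\<Sum>e\<in>UNIV. p $ e *\<^sub>R row e K)"
  by (simp add: vec_eq_iff matrix_vector_mult_def transpose_def row_def mult.commute
      del: transpose_matrix_vector)

lemma matrix_mult_row_inner:
  fixes K :: "real^'v^'e"
  shows "(K *v x) $ e = row e K \<bullet> x"
  by (simp add: matrix_vector_mult_def row_def inner_vec_def)

lemma row_weighted_grad_matrix:
  "row e (weighted_grad_matrix \<omega> src dst) = \<omega> e *\<^sub>R row e (grad_matrix src dst)"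
  by (simp add: vec_eq_iff row_def weighted_grad_matrix_def diag_matrix_def
      matrix_matrix_mult_def if_distrib[of "\<lambda>x. x * _"] cong: if_cong)

text \<open>If \<open>p\<close> were nonzero, the forest of edges carrying it would have a leaf \<open>w\<close>, and the component at \<open>w\<close>
  of the linear combination of rows would consist of a single nonzero term.\<close>

lemma forest_rows_independent:
  fixes ends :: "'e::finite \<Rightarrow> 'v::finite set" and p :: "real^'e"
  assumes graph: "undirected_graph ends" and ori: "orientation ends src dst"
    and \<omega>: "\<And>e. \<omega> e > 0" and forest: "is_forest ends F"
    and supp: "\<And>e. e \<notin> F \<Longrightarrow> p $ e = 0"
    and zero: "transpose (weighted_grad_matrix \<omega> src dst) *v p = 0"
  shows "p = 0"
proof (rule ccontr)
  assume "p \<noteq> 0"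
  define S where "S = {e. p $ e \<noteq> 0}"
  have S: "S \<subseteq> F" "S \<noteq> {}" using \<open>p \<noteq> 0\<close> supp by (auto simp: vec_eq_iff S_def)
  obtain e w where eS: "e \<in> S" and w: "w \<in> ends e"
    and unique: "\<forall>e'\<in>S. w \<in> ends e' \<longrightarrow> e' = e"
    using forest_has_leaf[OF graph forest S] by blast
  have e: "p $ e \<noteq> 0" using eS by (simp add: S_def)
  have leaf: "e' = e" if "p $ e' \<noteq> 0" "w \<in> ends e'" for e'
    using unique that unfolding S_def by blast
  let ?g = "\<lambda>e'. (if w = src e' then 1 else 0) - (if w = dst e' then 1 else 0) :: real"
  have en: "ends e' = {src e', dst e'}" for e' using ori by (simp add: orientation_def)
  have "card {src e, dst e} = 2" using graph unfolding undirected_graph_def en[symmetric] by blast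
  hence "src e \<noteq> dst e" by auto
  hence g: "?g e \<noteq> 0" using w en[of e] by auto
  have "(transpose (weighted_grad_matrix \<omega> src dst) *v p) $ w = (\<Sum>e'\<in>UNIV. p $ e' * (\<omega> e' * ?g e'))"
    unfolding transpose_mult_eq_sum_rows row_weighted_grad_matrix
    by (simp add: row_def grad_matrix_def mult.assoc)
  also have "\<dots> = (\<Sum>e'\<in>UNIV. if e' = e then p $ e * (\<omega> e * ?g e) else 0)"
  proof (intro sum.cong refl)
    fix e'
    show "p $ e' * (\<omega> e' * ?g e') = (if e' = e then p $ e * (\<omega> e * ?g e) else 0)"
    proof (cases "e' = e \<or> p $ e' = 0")
      case False
      hence "w \<notin> ends e'" using leaf by blast
      hence "?g e' = 0" using en[of e'] by auto
      thus ?thesis using False by simp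
    qed auto
  qed
  also have "\<dots> = p $ e * (\<omega> e * ?g e)" by simp
  finally have "p $ e * (\<omega> e * ?g e) = 0" using zero by simp
  thus False using e g \<omega>[of e] by simp
qed

section \<open>Positive definiteness of the preconditioner\<close>

lemma transpose_coord_proj: "transpose (coord_proj S) = coord_proj S"
  by (simp add: coord_proj_def diag_matrix_def transpose_def vec_eq_iff)

lemma coord_proj_inner:
  fixes p q :: "real^'e::finite"
  shows "p \<bullet> (coord_proj S *v q) = (coord_proj S *v p) \<bullet> q"
  by (simp only: inner_matrix_vector_transpose transpose_coord_proj)

lemma coord_proj_idem:
  fixes p :: "real^'e::finite"
  shows "coord_proj S *v (coord_proj S *v p) = coord_proj S *v p"
  by (simp add: vec_eq_iff coord_proj_mult)

lemma preconditioner_mult: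
  fixes K :: "real^'v^'e::finite"
  shows "preconditioner K L F *v p =
    (\<Sum>l=1..L. coord_proj (F l) *v (K *v (transpose K *v (coord_proj (F l) *v p))))"
proof -
  have sum_mult: "(\<Sum>l\<in>X. M l) *v p = (\<Sum>l\<in>X. M l *v p)" for X and M :: "nat \<Rightarrow> real^'e^'e"
    by (induction X rule: infinite_finite_induct) (simp_all add: matrix_vector_mult_add_rdistrib)
  show ?thesis
    unfolding preconditioner_def sum_mult Let_def
    by (simp only: matrix_transpose_mul transpose_coord_proj matrix_vector_mul_assoc[symmetric]
        coord_proj_idem)
qed

lemma preconditioner_mult_component:
  fixes K :: "real^'v^'e::finite"
  assumes disj: "disjoint_family_on F {1..L}" and l: "l \<in> {1..L}" and e: "e \<in> F l"
  shows "(preconditioner K L F *v p) $ e = row e K \<bullet> (transpose K *v (coord_proj (F l) *v p))"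
proof -
  have "e \<in> F l' \<longleftrightarrow> l' = l" if "l' \<in> {1..L}" for l'
    using disj l e that unfolding disjoint_family_on_def by blast
  hence "(preconditioner K L F *v p) $ e =
      (\<Sum>l'=1..L. if l' = l then row e K \<bullet> (transpose K *v (coord_proj (F l) *v p)) else 0)"
    unfolding preconditioner_mult sum_component
    by (intro sum.cong) (auto simp: coord_proj_mult matrix_mult_row_inner[of K]
        simp del: transpose_matrix_vector)
  thus ?thesis using l by simp
qed

lemma preconditioner_quadratic_form:
  fixes K :: "real^'v^'e::finite"
  shows "p \<bullet> (preconditioner K L F *v p) =
    (\<Sum>l=1..L. (norm (transpose K *v (coord_proj (F l) *v p)))\<^sup>2)"
  unfolding preconditioner_mult inner_sum_right
  by (simp only: coord_proj_inner inner_matrix_vector_transpose[of _ K] dot_square_norm)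

lemma preconditioner_psd:
  fixes K :: "real^'v^'e::finite"
  shows "psd_matrix (preconditioner K L F)"
proof -
  let ?T = "preconditioner K L F"
  have "(transpose ?T *v p) \<bullet> q = (?T *v p) \<bullet> q" for p q
    unfolding inner_matrix_vector_transpose[symmetric] preconditioner_mult inner_sum_right inner_sum_left
    by (intro sum.cong refl)
      (simp only: inner_commute[of _ q] coord_proj_inner inner_matrix_vector_transpose[of _ K],
        rule inner_commute)
  hence "transpose ?T *v p = ?T *v p" for p using vector_eq_rdot by blast
  hence "transpose ?T = ?T" by (simp only: matrix_eq simp_thms)
  thus ?thesis by (simp add: psd_matrix_def preconditioner_quadratic_form sum_nonneg)
qed

text \<open>This is where the forest property enters: it makes the form of \<open>T\<close>, a sum of squares over
  the parts, definite, and so \<open>T\<close> has an inverse square root.\<close>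

lemma preconditioner_pd:
  fixes ends :: "'e::finite \<Rightarrow> 'v::finite set"
  assumes graph: "undirected_graph ends" and ori: "orientation ends src dst"
    and \<omega>: "\<And>e. \<omega> e > 0" and part: "forest_partition ends L F"
  shows "pd_matrix (preconditioner (weighted_grad_matrix \<omega> src dst) L F)"
  unfolding pd_matrix_def
proof (intro conjI preconditioner_psd allI impI)
  fix p :: "real^'e"
  assume zero: "p \<bullet> (preconditioner (weighted_grad_matrix \<omega> src dst) L F *v p) = 0"
  let ?K = "weighted_grad_matrix \<omega> src dst"
  have Kz: "transpose ?K *v (coord_proj (F l) *v p) = 0" if "l \<in> {1..L}" for l
    using zero that unfolding preconditioner_quadratic_form by (simp add: sum_nonneg_eq_0_iff)
  have "coord_proj (F l) *v p = 0" if "l \<in> {1..L}" for l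
    using forest_rows_independent[OF graph ori \<omega> _ _ Kz[OF that], of "F l"] part that
    by (auto simp: forest_partition_def coord_proj_mult)
  hence "p $ e = 0" if "e \<in> F l" "l \<in> {1..L}" for e l
    using that by (metis coord_proj_mult zero_index)
  moreover have "\<exists>l\<in>{1..L}. e \<in> F l" for e using part by (auto simp: forest_partition_def)
  ultimately show "p = 0" by (metis vec_eq_iff zero_index)
qed

section \<open>The inactive operator as a sum of projections\<close>

text \<open>Positive weights rescale the rows without changing their span.\<close>

lemma edge_span_weighted:
  assumes \<omega>: "\<And>e. \<omega> e > 0"
  shows "edge_span src dst S = span ((\<lambda>e. row e (weighted_grad_matrix \<omega> src dst)) ` S)"
proof -
  let ?g = "\<lambda>e. row e (grad_matrix src dst)" and ?k = "\<lambda>e. row e (weighted_grad_matrix \<omega> src dst)"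
  have k: "?k e = \<omega> e *\<^sub>R ?g e" for e by (rule row_weighted_grad_matrix)
  have g: "?g e = (1 / \<omega> e) *\<^sub>R ?k e" for e using \<omega>[of e] by (simp add: k)
  have "span (?g ` S) = span (?k ` S)"
  proof (rule span_eq[THEN iffD2], intro conjI subsetI)
    fix x assume "x \<in> ?g ` S"
    thus "x \<in> span (?k ` S)" using g by (auto intro!: span_scale intro: span_base)
  next
    fix x assume "x \<in> ?k ` S"
    thus "x \<in> span (?g ` S)" by (auto simp: k intro!: span_scale intro: span_base)
  qed
  thus ?thesis by (simp add: edge_span_def setcompr_eq_image)
qed

lemma subspace_inactive_space: "subspace (inactive_space T A)"
  unfolding inactive_space_def by (auto simp: subspace_def matrix_vector_right_distrib matrix_vector_mult_scaleR)

text \<open>An orthogonal projection is its own Gram matrix, and \<open>T\<^sup>-\<^sup>1\<^sup>/\<^sup>2\<close> is symmetric. The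
  singular values that define the rate constant are therefore the square roots of the eigenvalues of
  \<open>\<Pi>\<^sub>I\<close>.\<close>

lemma Pi_inactive_gram:
  fixes K :: "real^'v^'e::finite" and A :: "'e set"
  assumes pd: "pd_matrix T"
  defines "B \<equiv> projection_matrix (inactive_space T A) ** inv_sqrt_matrix T ** K"
  shows "transpose B ** B = Pi_inactive K T A"
proof -
  let ?P = "projection_matrix (inactive_space T A)" and ?R = "inv_sqrt_matrix T"
  have "transpose B ** B = transpose K ** ?R ** (transpose ?P ** ?P) ** ?R ** K"
    unfolding B_def matrix_transpose_mul inv_sqrt_matrix(1)[OF pd]
    by (simp only: matrix_mul_assoc)
  thus ?thesis by (simp only: projection_matrix_gram[OF subspace_inactive_space] Pi_inactive_def)
qed

text \<open>Substituting \<open>p = T\<^sup>1\<^sup>/\<^sup>2 q\<close> removes the square root: membership of \<open>p\<close> in \<open>U(A)\<close> says that \<open>q\<close>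
  vanishes on \<open>A\<close>, and the residual of \<open>p\<close> is orthogonal to \<open>U(A)\<close>, which is spanned by the vectors
  \<open>T\<^sup>1\<^sup>/\<^sup>2 e\<close> with \<open>e\<close> a unit vector of an inactive edge, exactly if \<open>T q\<close> and \<open>K x\<close> agree on \<open>I\<close>.\<close>

lemma Pi_inactive_mult:
  fixes K :: "real^'v^'e::finite"
  assumes pd: "pd_matrix T"
    and AI: "A \<inter> I = {}" "A \<union> I = UNIV"
  shows "\<exists>q. (\<forall>e\<in>A. q $ e = 0) \<and> (\<forall>e\<in>I. (T *v q) $ e = (K *v x) $ e) \<and>
    Pi_inactive K T A *v x = transpose K *v q"
proof -
  let ?R = "inv_sqrt_matrix T" and ?U = "inactive_space T A"
  note R = inv_sqrt_matrix[OF pd]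
  note U = subspace_inactive_space[of T A]
  have S: "transpose (sqrt_matrix T) = sqrt_matrix T" "sqrt_matrix T ** sqrt_matrix T = T"
    using sqrt_matrix pd by (auto simp: pd_matrix_def psd_matrix_def)
  define p where "p = orthogonal_projection ?U (?R *v (K *v x))"
  define q where "q = ?R *v p"
  have "q $ e = 0" if "e \<in> A" for e
  proof -
    have "coord_proj A *v q = 0"
      using orthogonal_projection_in[OF U, of "?R *v (K *v x)"]
      by (simp add: p_def q_def inactive_space_def matrix_vector_mul_assoc)
    thus ?thesis using coord_proj_mult[of A q e] that by simp
  qed
  moreover have "(T *v q) $ e = (K *v x) $ e" if e: "e \<in> I" for e
  proof -
    let ?u = "sqrt_matrix T *v axis e 1"
    have "coord_proj A *v axis e 1 = 0"
      using e AI by (auto simp: vec_eq_iff coord_proj_mult axis_def)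
    hence "?u \<in> ?U" by (simp add: inactive_space_def matrix_vector_mul_assoc[symmetric] R)
    from orthogonal_projection_residual[OF U this, of "?R *v (K *v x)"]
    have "(?R *v (K *v x)) \<bullet> ?u = p \<bullet> ?u" by (simp add: p_def inner_diff_left)
    moreover have "(?R *v (K *v x)) \<bullet> ?u = (K *v x) \<bullet> axis e 1"
      unfolding inner_matrix_vector_transpose S R ..
    moreover have "p \<bullet> ?u = (T *v q) \<bullet> axis e 1"
    proof -
      have "p = sqrt_matrix T *v q" by (simp add: q_def R)
      hence "p \<bullet> ?u = (sqrt_matrix T *v (sqrt_matrix T *v q)) \<bullet> axis e 1"
        unfolding inner_matrix_vector_transpose[of p] S by simp
      thus ?thesis by (simp only: matrix_vector_mul_assoc S)
    qed
    ultimately show ?thesis by (simp add: inner_axis)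
  qed
  moreover have "Pi_inactive K T A *v x = transpose K *v q"
    by (simp only: Pi_inactive_def p_def q_def projection_matrix_mult[OF U]
        matrix_vector_mul_assoc[symmetric])
  ultimately show ?thesis by blast
qed

text \<open>The coordinates on the parts \<open>F l\<close> do not interact in \<open>T\<close>, so the equations \<open>(T q)\<^sub>e = (K x)\<^sub>e\<close> for
  \<open>e \<in> I \<inter> F l\<close> say that \<open>s l = K\<^sup>T P\<^sub>l q\<close> and \<open>x\<close> have the same inner product with the rows of those
  edges. As \<open>s l\<close> is a combination of these rows, it is the orthogonal projection of \<open>x\<close> onto
  their span.\<close>

lemma Pi_inactive_preconditioner_mult:
  fixes K :: "real^'v^'e::finite" and L :: nat and F :: "nat \<Rightarrow> 'e set"
  defines "T \<equiv> preconditioner K L F"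
  assumes pd: "pd_matrix T"
    and disj: "disjoint_family_on F {1..L}" and cover: "(\<Union>l\<in>{1..L}. F l) = UNIV"
    and AI: "A \<inter> I = {}" "A \<union> I = UNIV"
  shows "Pi_inactive K T A *v x =
    (\<Sum>l=1..L. orthogonal_projection (span ((\<lambda>e. row e K) ` (I \<inter> F l))) x)"
proof -
  obtain q where qA: "\<And>e. e \<in> A \<Longrightarrow> q $ e = 0"
    and Tq: "\<And>e. e \<in> I \<Longrightarrow> (T *v q) $ e = (K *v x) $ e"
    and Pi: "Pi_inactive K T A *v x = transpose K *v q"
    using Pi_inactive_mult[OF pd AI, of K x] by blast
  define s where "s l = transpose K *v (coord_proj (F l) *v q)" for l
  have proj: "orthogonal_projection (span ((\<lambda>e. row e K) ` (I \<inter> F l))) x = s l"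
    if l: "l \<in> {1..L}" for l
  proof (rule orthogonal_projection_eqI)
    have "s l = (\<Sum>e\<in>UNIV. (coord_proj (F l) *v q) $ e *\<^sub>R row e K)"
      unfolding s_def by (rule transpose_mult_eq_sum_rows)
    also have "\<dots> \<in> span ((\<lambda>e. row e K) ` (I \<inter> F l))"
    proof (rule span_sum)
      fix e
      have "e \<in> A \<or> e \<in> I" using AI by blast
      thus "(coord_proj (F l) *v q) $ e *\<^sub>R row e K \<in> span ((\<lambda>e. row e K) ` (I \<inter> F l))"
        using qA by (auto simp: coord_proj_mult span_zero intro: span_scale span_base)
    qed
    finally show "s l \<in> span ((\<lambda>e. row e K) ` (I \<inter> F l))" .
    show "orthogonal (x - s l) u" if "u \<in> span ((\<lambda>e. row e K) ` (I \<inter> F l))" for u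
    proof (rule orthogonal_to_span[OF that])
      fix y assume "y \<in> (\<lambda>e. row e K) ` (I \<inter> F l)"
      then obtain e where e: "e \<in> I" "e \<in> F l" "y = row e K" by blast
      have "row e K \<bullet> s l = row e K \<bullet> x"
        using Tq[OF e(1)] preconditioner_mult_component[OF disj l e(2), of K q]
        by (simp only: T_def s_def matrix_mult_row_inner[of K])
      thus "orthogonal (x - s l) y" by (simp add: e orthogonal_def inner_diff_left inner_diff_right inner_commute)
    qed
  qed simp
  have "(\<Sum>l=1..L. coord_proj (F l) *v q) $ e = q $ e" for e
  proof -
    obtain l where l: "l \<in> {1..L}" "e \<in> F l" using cover by blast
    hence "e \<in> F l' \<longleftrightarrow> l' = l" if "l' \<in> {1..L}" for l'
      using disj that unfolding disjoint_family_on_def by blast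
    hence "(\<Sum>l=1..L. coord_proj (F l) *v q) $ e = (\<Sum>l'=1..L. if l' = l then q $ e else 0)"
      unfolding sum_component by (intro sum.cong) (auto simp: coord_proj_mult)
    thus ?thesis using l by simp
  qed
  hence "q = (\<Sum>l=1..L. coord_proj (F l) *v q)" by (simp add: vec_eq_iff)
  hence "transpose K *v q = transpose K *v (\<Sum>l=1..L. coord_proj (F l) *v q)" by (rule arg_cong)
  also have "\<dots> = (\<Sum>l=1..L. s l)" unfolding s_def
    by (rule linear_sum[OF matrix_vector_mul_linear])
  finally show ?thesis using proj Pi by simp
qed

section \<open>Spectrum of a sum of nested projections\<close>

text \<open>A sum of orthogonal projections onto a decreasing chain of subspaces acts on the part of \<open>S k\<close>
  orthogonal to \<open>S (Suc k)\<close> as multiplication by \<open>k\<close>. The chain is constant up to index \<open>m\<close> and drops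
  properly right after it, which makes \<open>m\<close> the least positive eigenvalue.\<close>

locale nested_projections =
  fixes M :: "real^'n^'n" and S :: "nat \<Rightarrow> (real^'n) set" and m L :: nat
  assumes M: "\<And>x. M *v x = (\<Sum>l=1..L. orthogonal_projection (S l) x)"
    and subspaces: "\<And>l. subspace (S l)"
    and decreasing: "\<And>k l. 1 \<le> k \<Longrightarrow> k \<le> l \<Longrightarrow> l \<le> L \<Longrightarrow> S l \<subseteq> S k"
    and m: "m \<in> {1..L}"
    and plateau: "\<And>l. l \<in> {1..m} \<Longrightarrow> S l = S 1"
    and drop: "m < L \<Longrightarrow> S (Suc m) \<subset> S m"
    and nonzero: "{0} \<subset> S L"
begin

lemma mult_eq_scale:
  assumes k: "k \<in> {1..L}" and x: "x \<in> S k"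
    and orth: "k < L \<Longrightarrow> orthogonal_projection (S (Suc k)) x = 0"
  shows "M *v x = real k *\<^sub>R x"
proof -
  have "orthogonal_projection (S l) x = (if l \<le> k then x else 0)" if l: "l \<in> {1..L}" for l
  proof (cases "l \<le> k")
    case True
    hence "x \<in> S l" using decreasing[of l k] x k l by auto
    thus ?thesis using True subspaces by (simp add: orthogonal_projection_ident)
  next
    case False
    hence "S l \<subseteq> S (Suc k)" "k < L" using decreasing[of "Suc k" l] l by auto
    thus ?thesis using orth orthogonal_projection_eq_0_mono[OF subspaces subspaces] False by simp
  qed
  hence "M *v x = (\<Sum>l=1..L. if l \<le> k then x else 0)" unfolding M by (intro sum.cong) auto
  also have "\<dots> = (\<Sum>l=1..k. x)" using k
    by (intro sum.mono_neutral_cong_right) auto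
  finally show ?thesis by (simp add: sum_constant_scaleR del: sum_constant)
qed

lemma eigenvalue_L: "eigenvalue M (real L)"
proof -
  obtain x where "x \<in> S L" "x \<noteq> 0" using nonzero by blast
  thus ?thesis using mult_eq_scale[of L x] m by (auto simp: eigenvalue_def)
qed

lemma eigenvalue_m: "eigenvalue M (real m)"
proof (cases "m < L")
  case True
  obtain v where v: "v \<in> S m" "v \<notin> S (Suc m)" using drop[OF True] by blast
  let ?P = "orthogonal_projection (S (Suc m))"
  define x where "x = v - ?P v"
  have Pv: "?P v \<in> S (Suc m)" by (rule orthogonal_projection_in[OF subspaces])
  have "x \<noteq> 0" using v Pv by (auto simp: x_def)
  moreover have "x \<in> S m" using v Pv drop[OF True] subspaces by (auto simp: x_def subspace_diff)
  moreover have "?P x = 0"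
    using orthogonal_projection_residual[OF subspaces]
    by (intro orthogonal_projection_of_orthogonal[OF subspaces]) (auto simp: x_def)
  ultimately show ?thesis using mult_eq_scale[OF m] by (auto simp: eigenvalue_def)
next
  case False
  thus ?thesis using eigenvalue_L m by (simp add: le_antisym)
qed

text \<open>If all projections annihilate the eigenvector \<open>x\<close>, then \<open>M x = 0\<close>. Otherwise let \<open>k\<close> be the last
  index whose projection does not. Applying \<open>P\<^sub>k\<close>
  to \<open>M x = c x\<close> turns each of the first \<open>k\<close> summands into \<open>P\<^sub>k x\<close> and the
  others into \<open>0\<close>, so \<open>c = k\<close>.\<close>

lemma eigenvalue_cases:
  assumes "eigenvalue M c"
  shows "c = 0 \<or> c \<in> real ` {m..L}"
proof -
  obtain x where x: "x \<noteq> 0" "M *v x = c *\<^sub>R x" using assms by (auto simp: eigenvalue_def)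
  let ?P = "\<lambda>l. orthogonal_projection (S l)"
  define J where "J = {l \<in> {1..L}. ?P l x \<noteq> 0}"
  show ?thesis
  proof (cases "J = {}")
    case True
    hence "M *v x = 0" unfolding M by (intro sum.neutral) (auto simp: J_def)
    thus ?thesis using x by simp
  next
    case False
    define k where "k = Max J"
    have "finite J" by (simp add: J_def)
    have "k \<in> J" unfolding k_def using \<open>finite J\<close> False by (rule Max_in)
    hence k: "k \<in> {1..L}" "?P k x \<noteq> 0" by (auto simp: J_def)
    have max: "?P l x = 0" if "l \<in> {1..L}" "k < l" for l
      using Max_ge[OF \<open>finite J\<close>, of l] that unfolding k_def J_def by fastforce
    note lin = linear_orthogonal_projection[OF subspaces[of k]]
    have "c *\<^sub>R ?P k x = ?P k (M *v x)" using x by (simp add: linear_cmul[OF lin])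
    also have "\<dots> = (\<Sum>l=1..L. ?P k (?P l x))" unfolding M by (rule linear_sum[OF lin])
    also have "\<dots> = (\<Sum>l=1..L. if l \<le> k then ?P k x else 0)"
    proof (rule sum.cong[OF refl])
      fix l assume l: "l \<in> {1..L}"
      show "?P k (?P l x) = (if l \<le> k then ?P k x else 0)"
      proof (cases "l \<le> k")
        case True
        thus ?thesis using decreasing[of l k] l k
          by (simp add: orthogonal_projection_nested[OF subspaces subspaces])
      next
        case False
        thus ?thesis using max[OF l] by (simp add: linear_0[OF lin])
      qed
    qed
    also have "\<dots> = (\<Sum>l=1..k. ?P k x)" using k by (intro sum.mono_neutral_cong_right) auto
    also have "\<dots> = real k *\<^sub>R ?P k x" by (simp add: sum_constant_scaleR del: sum_constant)
    finally have "c = real k" using k by simp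
    (* Below m the subspaces coincide with S m, so a last index below m is impossible. *)
    moreover have "m \<le> k"
    proof (rule ccontr)
      assume "\<not> m \<le> k"
      hence "k < m" by simp
      hence "S k = S m" using plateau[of k] plateau[of m] k m by simp
      thus False using max[OF m \<open>k < m\<close>] k by simp
    qed
    ultimately show ?thesis using k by auto
  qed
qed

lemma finite_eigenvalues: "finite {c. eigenvalue M c}"
  by (rule finite_subset[of _ "insert 0 (real ` {m..L})"]) (use eigenvalue_cases in auto)

lemma min_pos_eigenvalue: "min_pos_eigenvalue M = real m"
  unfolding min_pos_eigenvalue_def
proof (rule Min_eqI)
  show "finite {c. eigenvalue M c \<and> 0 < c}"
    by (rule finite_subset[OF _ finite_eigenvalues]) auto
  show "real m \<in> {c. eigenvalue M c \<and> 0 < c}" using eigenvalue_m m by simp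
  show "real m \<le> c" if "c \<in> {c. eigenvalue M c \<and> 0 < c}" for c
    using that by (auto dest!: eigenvalue_cases)
qed

lemma condition_number_gram:
  assumes "transpose B ** B = M"
  shows "(condition_number B)\<^sup>2 = real L / real m"
proof -
  have sv: "singular_values B = sqrt ` {c. eigenvalue M c}"
    by (auto simp: singular_values_def assms)
  have "Max (singular_values B) = sqrt (real L)"
  proof (rule Max_eqI)
    show "finite (singular_values B)" unfolding sv by (rule finite_imageI[OF finite_eigenvalues])
    show "sqrt (real L) \<in> singular_values B" using eigenvalue_L sv by blast
    show "\<sigma> \<le> sqrt (real L)" if "\<sigma> \<in> singular_values B" for \<sigma>
      using that by (auto simp: sv dest!: eigenvalue_cases)
  qed
  moreover have "Min {\<sigma> \<in> singular_values B. 0 < \<sigma>} = sqrt (real m)"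
  proof (rule Min_eqI)
    show "finite {\<sigma> \<in> singular_values B. 0 < \<sigma>}"
      unfolding sv using finite_imageI[OF finite_eigenvalues, of sqrt] by simp
    show "sqrt (real m) \<in> {\<sigma> \<in> singular_values B. 0 < \<sigma>}" using eigenvalue_m m sv by auto
    show "sqrt (real m) \<le> \<sigma>" if "\<sigma> \<in> {\<sigma> \<in> singular_values B. 0 < \<sigma>}" for \<sigma>
      using that by (auto simp: sv dest!: eigenvalue_cases)
  qed
  ultimately show ?thesis by (simp add: condition_number_def power_divide)
qed

end

section \<open>The convergence rate\<close>

lemma inactively_nestedD:
  assumes "inactively_nested src dst I L F lh"
  defines "S \<equiv> \<lambda>l. edge_span src dst (I \<inter> F l)"
  shows "lh \<in> {1..L}" and "l \<in> {1..lh} \<Longrightarrow> S l = S 1" and "lh < L \<Longrightarrow> S (Suc lh) \<subset> S lh"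
    and "lh < l \<Longrightarrow> l < L \<Longrightarrow> S (Suc l) \<subseteq> S l" and "{0} \<subset> S L"
  using assms(1) unfolding inactively_nested_def Let_def S_def by blast+

lemma inactively_nested_decreasing:
  assumes nested: "inactively_nested src dst I L F lh"
    and kl: "1 \<le> k" "k \<le> l" "l \<le> L"
  shows "edge_span src dst (I \<inter> F l) \<subseteq> edge_span src dst (I \<inter> F k)"
  using kl(2,3)
proof (induction l rule: dec_induct)
  case (step l)
  let ?S = "\<lambda>l. edge_span src dst (I \<inter> F l)"
  note N = inactively_nestedD[OF nested]
  have "?S (Suc l) \<subseteq> ?S l"
  proof (cases l lh rule: linorder_cases)
    case less
    hence "?S (Suc l) = ?S 1" "?S l = ?S 1" using N(2)[of "Suc l"] N(2)[of l] kl step by auto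
    thus ?thesis by (simp only: subset_refl)
  next
    case equal
    thus ?thesis using N(3) step by auto
  next
    case greater
    thus ?thesis using N(4) step by simp
  qed
  thus ?case using step by auto
qed simp

theorem theorem5:
  fixes ends :: "'e::finite \<Rightarrow> 'v::finite set"
    and src dst :: "'e \<Rightarrow> 'v"
    and \<omega> :: "'e \<Rightarrow> real"
    and L lh :: nat
    and F :: "nat \<Rightarrow> 'e set"
    and A I :: "'e set"
    and G :: "real^'v \<Rightarrow> ereal"
    and lG LG :: real
    and K :: "real^'v^'e"
    and T :: "real^'e^'e"
  defines "K \<equiv> weighted_grad_matrix \<omega> src dst"
    and "T \<equiv> preconditioner K L F"
  assumes "undirected_graph ends"
    and "orientation ends src dst"
    and "\<And>e. \<omega> e > 0"
    and "forest_partition ends L F"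
    and "A \<inter> I = {}" and "A \<union> I = UNIV"
    and "inactively_nested src dst I L F lh"
    and "proper_fun G" and "lsc_fun G" and "convex_fun G"
    and "lG > 0" and "LG > 0"
    and "C2_hessian_bounds (fenchel_conjugate G) lG LG"
  shows "min_pos_eigenvalue (Pi_inactive K T A) = real lh \<and>
         rate_constant K T A lG LG = real L / real lh * (LG / lG)"
proof -
  have pd: "pd_matrix T" unfolding T_def K_def by (rule preconditioner_pd[OF assms(3-6)])
  let ?S = "\<lambda>l. edge_span src dst (I \<inter> F l)"
  have parts: "disjoint_family_on F {1..L}" "(\<Union>l\<in>{1..L}. F l) = UNIV"
    using assms(6) by (auto simp: forest_partition_def)
  interpret nested_projections "Pi_inactive K T A" ?S lh L
  proof
    have span_eq: "?S l = span ((\<lambda>e. row e K) ` (I \<inter> F l))" for l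
      unfolding K_def by (rule edge_span_weighted) (rule assms(5))
    show "Pi_inactive K T A *v x = (\<Sum>l=1..L. orthogonal_projection (?S l) x)" for x
      unfolding span_eq T_def
      by (rule Pi_inactive_preconditioner_mult[OF pd[unfolded T_def] parts assms(7,8)])
    show "subspace (?S l)" for l by (simp add: edge_span_def)
    show "?S l \<subseteq> ?S k" if "1 \<le> k" "k \<le> l" "l \<le> L" for k l
      by (rule inactively_nested_decreasing[OF assms(9) that])
  qed (rule inactively_nestedD[OF assms(9)]; assumption)+
  show ?thesis
    using min_pos_eigenvalue condition_number_gram[OF Pi_inactive_gram[OF pd]]
    by (simp add: rate_constant_def)
qed

end
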